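(* Let $g_{ab}$ be a Lorentzian metric of signature $(-+++)$ and $T_{ab}$ a real symmetric tensor at a spacetime point, let $\{n^a,e_1^a,e_2^a,e_3^a\}$ be an orthonormal tetrad at that point with $n^a$ future-directed timelike, let $\eta=\mathrm{diag}(-1,1,1,1)$, and let $\widehat T$ be the real symmetric $4\times4$ matrix of tetrad-frame components of $T_{ab}$. Put $M(\sigma)=\widehat T+\sigma\eta$ for $\sigma\in\mathbb{R}$. Let $\Theta_{ab}=T_{ab}-\tfrac12 T g_{ab}$ with $T=g^{ab}T_{ab}$, let $\widehat\Theta$ be its tetrad-frame component matrix, and let $(T^2)_{ab}=T_{ac}g^{cd}T_{db}$. Then, with no hypothesis on the Hawking--Ellis (algebraic) type of $T^a{}_b$: (i) the null energy condition (NEC) holds at the point if and only if $M(\sigma)\succeq0$ for some $\sigma\in\mathbb{R}$; (ii) the weak energy condition (WEC) holds at the point if and only if $M(\sigma)\succeq0$ for some $\sigma\ge0$; (iii) the strong energy condition (SEC) holds at the point if and only if the WEC holds for $\Theta_{ab}$ in place of $T_{ab}$, i.e. if and only if $\widehat\Theta+\sigma\eta\succeq0$ for some $\sigma\ge0$; (iv) the dominant energy condition (DEC) holds at the point if and only if the WEC holds for $T_{ab}$ and the WEC holds for $-(T^2)_{ab}$ in place of $T_{ab}$.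
   Context: All statements are at a single spacetime point; indices are raised and lowered with $g_{ab}$. Orthonormal tetrad: $g_{ab}n^an^b=-1$, $g_{ab}n^ae_i^b=0$, $g_{ab}e_i^ae_j^b=\delta_{ij}$. With $\rho_n=T_{ab}n^an^b$, $b_i=-T_{ab}n^ae_i^b$, $S_{ij}=T_{ab}e_i^ae_j^b$, the matrix $\widehat T$ has entries $\widehat T_{00}=\rho_n$, $\widehat T_{0i}=\widehat T_{i0}=-b_i$, $\widehat T_{ij}=S_{ij}$, so that $$M(\sigma)=\begin{pmatrix}\rho_n-\sigma & -b^{\mathsf T}\\ -b & S+\sigma\mathbb{1}\end{pmatrix}.$$ $A\succeq0$ means that the real symmetric matrix $A$ is positive semidefinite. Energy conditions at the point (for a symmetric tensor $T_{ab}$): NEC: $T_{ab}k^ak^b\ge0$ for all null $k^a$. WEC: $T_{ab}u^au^b\ge0$ for all timelike $u^a$. SEC: $(T_{ab}-\tfrac12 T g_{ab})u^au^b\ge0$ for all timelike $u^a$, where $T=g^{ab}T_{ab}$. DEC: for all future-directed timelike $u^a$, $T_{ab}u^au^b\ge0$ and the vector $J^a=-T^a{}_bu^b$ is future causal, i.e. lies in the closed future causal cone ($J_aJ^a\le0$ and $J^a$ is future-directed or zero). *)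

theory Defs
  imports "HOL-Analysis.Analysis"
begin

text \<open>
  The tangent space at the point is \<open>real ^ 4\<close> (components in an arbitrary basis).  Covariant
  2-tensors such as \<open>g\<^sub>a\<^sub>b\<close> and \<open>T\<^sub>a\<^sub>b\<close> are their component matrices, and \<open>g\<^sup>a\<^sup>b\<close> is \<open>matrix_inv g\<close>.
  In the index type \<open>4\<close> the numeral \<open>4\<close> equals \<open>0\<close>, so that its elements are \<open>0, 1, 2, 3\<close>.
\<close>

definition contract :: "real ^ 4 ^ 4 \<Rightarrow> real ^ 4 \<Rightarrow> real ^ 4 \<Rightarrow> real" where
  "contract T u v = (\<Sum>a\<in>UNIV. \<Sum>b\<in>UNIV. T $ a $ b * u $ a * v $ b)"

lemma contract_eq_inner: "contract T u v = u \<bullet> (T *v v)"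
  by (simp add: contract_def inner_vec_def matrix_vector_mult_def sum_distrib_left mult_ac)

definition minkowski :: "real ^ 4 ^ 4" where
  "minkowski = (\<chi> \<mu> \<nu>. if \<mu> \<noteq> \<nu> then 0 else if \<mu> = 0 then - 1 else 1)"

definition symmetric :: "real ^ 'n ^ 'n \<Rightarrow> bool" where
  "symmetric A \<longleftrightarrow> transpose A = A"

definition lorentzian :: "real ^ 4 ^ 4 \<Rightarrow> bool" where
  "lorentzian g \<longleftrightarrow> symmetric g \<and> (\<exists>P. invertible P \<and> transpose P ** g ** P = minkowski)"

definition timelike :: "real ^ 4 ^ 4 \<Rightarrow> real ^ 4 \<Rightarrow> bool" where
  "timelike g u \<longleftrightarrow> contract g u u < 0"

definition null :: "real ^ 4 ^ 4 \<Rightarrow> real ^ 4 \<Rightarrow> bool" where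
  "null g k \<longleftrightarrow> k \<noteq> 0 \<and> contract g k k = 0"

text \<open>
  The time orientation is given by a timelike vector \<open>t\<close>: a nonzero causal vector is
  future-directed iff it lies in the same half of the causal cone as \<open>t\<close>.
\<close>

definition future_directed :: "real ^ 4 ^ 4 \<Rightarrow> real ^ 4 \<Rightarrow> real ^ 4 \<Rightarrow> bool" where
  "future_directed g t v \<longleftrightarrow> v \<noteq> 0 \<and> contract g v v \<le> 0 \<and> contract g t v < 0"

definition future_causal :: "real ^ 4 ^ 4 \<Rightarrow> real ^ 4 \<Rightarrow> real ^ 4 \<Rightarrow> bool" where
  "future_causal g t v \<longleftrightarrow> contract g v v \<le> 0 \<and> (future_directed g t v \<or> v = 0)"

definition tetrad :: "real ^ 4 \<Rightarrow> real ^ 4 \<Rightarrow> real ^ 4 \<Rightarrow> real ^ 4 \<Rightarrow> 4 \<Rightarrow> real ^ 4" where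
  "tetrad n e1 e2 e3 \<mu> = (if \<mu> = 0 then n else if \<mu> = 1 then e1 else if \<mu> = 2 then e2 else e3)"

definition orthonormal_tetrad ::
    "real ^ 4 ^ 4 \<Rightarrow> real ^ 4 \<Rightarrow> real ^ 4 \<Rightarrow> real ^ 4 \<Rightarrow> real ^ 4 \<Rightarrow> bool" where
  "orthonormal_tetrad g n e1 e2 e3 \<longleftrightarrow>
     contract g n n = - 1 \<and>
     (\<forall>i\<in>{1, 2, 3}. contract g n (tetrad n e1 e2 e3 i) = 0) \<and>
     (\<forall>i\<in>{1, 2, 3}. \<forall>j\<in>{1, 2, 3}.
        contract g (tetrad n e1 e2 e3 i) (tetrad n e1 e2 e3 j) = (if i = j then 1 else 0))"

definition frame_components :: "(4 \<Rightarrow> real ^ 4) \<Rightarrow> real ^ 4 ^ 4 \<Rightarrow> real ^ 4 ^ 4" where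
  "frame_components E T = (\<chi> \<mu> \<nu>. contract T (E \<mu>) (E \<nu>))"

lemma contract_commute:
  assumes "symmetric T"
  shows "contract T u v = contract T v u"
proof -
  have *: "T $ a $ b = T $ b $ a" for a b
    using arg_cong[OF assms[unfolded symmetric_def], of "\<lambda>A. A $ b $ a"]
    by (simp add: transpose_def)
  have "contract T u v = (\<Sum>b\<in>UNIV. \<Sum>a\<in>UNIV. T $ a $ b * u $ a * v $ b)"
    unfolding contract_def by (rule sum.swap)
  also have "\<dots> = contract T v u"
    unfolding contract_def by (intro sum.cong refl) (subst *, simp only: mult_ac)
  finally show ?thesis .
qed

text \<open>
  The block form of the frame components with \<open>\<rho> = T\<^sub>a\<^sub>b n\<^sup>a n\<^sup>b\<close>, \<open>b\<^sub>i = - T\<^sub>a\<^sub>b n\<^sup>a e\<^sub>i\<^sup>b\<close> and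
  \<open>S\<^sub>i\<^sub>j = T\<^sub>a\<^sub>b e\<^sub>i\<^sup>a e\<^sub>j\<^sup>b\<close>: the off-diagonal blocks are \<open>- b\<close>.
\<close>

lemma frame_components_blocks:
  fixes T :: "real ^ 4 ^ 4" and n e1 e2 e3 :: "real ^ 4"
  defines "E \<equiv> tetrad n e1 e2 e3"
  defines "\<rho> \<equiv> contract T n n" and "b \<equiv> \<lambda>i. - contract T n (E i)"
    and "S \<equiv> \<lambda>i j. contract T (E i) (E j)"
  assumes sym: "symmetric T"
  shows "frame_components E T $ 0 $ 0 = \<rho>"
    and "frame_components E T $ 0 $ i = - b i"
    and "frame_components E T $ i $ 0 = - b i"
    and "frame_components E T $ i $ j = S i j"
  using contract_commute[OF sym, of "E i" n]
  by (auto simp: frame_components_def E_def \<rho>_def b_def S_def tetrad_def)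

definition psd :: "real ^ 'n ^ 'n \<Rightarrow> bool" where
  "psd A \<longleftrightarrow> symmetric A \<and> (\<forall>x. 0 \<le> x \<bullet> (A *v x))"

definition tensor_trace :: "real ^ 4 ^ 4 \<Rightarrow> real ^ 4 ^ 4 \<Rightarrow> real" where
  "tensor_trace g T = (\<Sum>a\<in>UNIV. \<Sum>b\<in>UNIV. matrix_inv g $ a $ b * T $ a $ b)"

definition trace_reversed :: "real ^ 4 ^ 4 \<Rightarrow> real ^ 4 ^ 4 \<Rightarrow> real ^ 4 ^ 4" where
  "trace_reversed g T = T - (1 / 2 * tensor_trace g T) *\<^sub>R g"

definition tensor_square :: "real ^ 4 ^ 4 \<Rightarrow> real ^ 4 ^ 4 \<Rightarrow> real ^ 4 ^ 4" where
  "tensor_square g T = T ** matrix_inv g ** T"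

definition NEC :: "real ^ 4 ^ 4 \<Rightarrow> real ^ 4 ^ 4 \<Rightarrow> bool" where
  "NEC g T \<longleftrightarrow> (\<forall>k. null g k \<longrightarrow> contract T k k \<ge> 0)"

definition WEC :: "real ^ 4 ^ 4 \<Rightarrow> real ^ 4 ^ 4 \<Rightarrow> bool" where
  "WEC g T \<longleftrightarrow> (\<forall>u. timelike g u \<longrightarrow> contract T u u \<ge> 0)"

definition SEC :: "real ^ 4 ^ 4 \<Rightarrow> real ^ 4 ^ 4 \<Rightarrow> bool" where
  "SEC g T \<longleftrightarrow>
     (\<forall>u. timelike g u \<longrightarrow> contract (T - (1 / 2 * tensor_trace g T) *\<^sub>R g) u u \<ge> 0)"

definition DEC :: "real ^ 4 ^ 4 \<Rightarrow> real ^ 4 \<Rightarrow> real ^ 4 ^ 4 \<Rightarrow> bool" where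
  "DEC g t T \<longleftrightarrow>
     (\<forall>u. timelike g u \<and> future_directed g t u \<longrightarrow>
        contract T u u \<ge> 0 \<and> future_causal g t (- ((matrix_inv g ** T) *v u)))"

end

theory Submission
  imports Defs
begin

text \<open>
  A tetrad turns \<open>M(\<sigma>)\<close> into the quadratic form of \<open>T + \<sigma> g\<close>, so (i) and (ii) are the two
  versions of the S-lemma.  Given a vector \<open>u\<close> on which \<open>g\<close> is negative and a vector \<open>v\<close> on which
  it is positive, the plane they span contains two null directions; a positive combination of the
  values of \<open>T\<close> there gives \<open>- T(v,v) / g(v,v) \<le> T(u,u) / - g(u,u)\<close>.  Hence the infimum of the
  right-hand sides is an admissible \<open>\<sigma>\<close>, and it is nonnegative under the WEC.  For (iv), the flux
  vector \<open>J\<close> satisfies \<open>g(J,J) = T\<^sup>2(u,u)\<close> and \<open>g(u,J) = - T(u,u)\<close>; since a nonzero causal vector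
  is never orthogonal to a timelike one, the signs of these two numbers decide whether \<open>J\<close> is
  future causal.
\<close>

subsection \<open>The homogeneous S-lemma\<close>

lemma symmetric_inner_commute:
  fixes A :: "real ^ 'n ^ 'n"
  assumes "symmetric A"
  shows "x \<bullet> (A *v y) = y \<bullet> (A *v x)"
  using assms unfolding symmetric_def by (metis dot_lmul_matrix inner_commute transpose_matrix_vector)

lemma quadratic_form_add_scaled:
  fixes A :: "real ^ 'n ^ 'n"
  assumes "symmetric A"
  shows "(c *\<^sub>R u + v) \<bullet> (A *v (c *\<^sub>R u + v))
    = c\<^sup>2 * (u \<bullet> (A *v u)) + 2 * c * (u \<bullet> (A *v v)) + v \<bullet> (A *v v)"
  using symmetric_inner_commute[OF assms, of v u]
  by (simp add: matrix_vector_right_distrib matrix_vector_mult_scaleR inner_add_left inner_add_right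
      algebra_simps power2_eq_square)

text \<open>The product of the two roots is \<open>c / a < 0\<close>. Applied with \<open>a\<close>,
  \<open>b\<close>, \<open>c\<close> read off from \<open>G\<close> on the plane of \<open>u\<close>
  and \<open>v\<close>, the roots give the null vectors \<open>r u + v\<close> and
  \<open>s u + v\<close>.\<close>

lemma quadratic_roots_opposite_signs:
  fixes a b c :: real
  assumes "a < 0" "0 < c"
  obtains r s where "s < 0" "0 < r" "a * (r * s) = c"
    "r\<^sup>2 * a + 2 * r * b + c = 0" "s\<^sup>2 * a + 2 * s * b + c = 0"
proof -
  define d where "d = sqrt (b\<^sup>2 - a * c)"
  have ac: "a * c < 0"
    using assms by (simp add: mult_neg_pos)
  have "b\<^sup>2 < b\<^sup>2 - a * c"
    using ac by simp
  then have "sqrt (b\<^sup>2) < d"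
    unfolding d_def by (rule real_sqrt_less_mono)
  then have d: "\<bar>b\<bar> < d"
    by simp
  have d2: "d\<^sup>2 = b\<^sup>2 - a * c"
    unfolding d_def using ac by (intro real_sqrt_pow2) (smt (verit) zero_le_power2)
  define r s where "r = (- b - d) / a" and "s = (- b + d) / a"
  have ar: "a * r = - b - d" and as: "a * s = - b + d"
    using assms by (simp_all add: r_def s_def)
  have "0 < r" "s < 0"
    using d assms by (auto simp: r_def s_def field_simps)
  \<comment> \<open>This identity and the next two are proved after multiplication by
    \<open>a\<close>, so that the roots enter only through \<open>a * r\<close> and
    \<open>a * s\<close>; the factor is cancelled at the end.\<close>
  moreover have "a * (a * (r * s)) = a * c"
  proof -
    have "a * (a * (r * s)) = (a * r) * (a * s)" by simp
    also have "\<dots> = b\<^sup>2 - d\<^sup>2" unfolding ar as by (simp add: algebra_simps power2_eq_square)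
    finally show ?thesis using d2 by simp
  qed
  moreover have "a * (r\<^sup>2 * a + 2 * r * b + c) = 0"
  proof -
    have "a * (r\<^sup>2 * a + 2 * r * b + c) = (a * r)\<^sup>2 + 2 * b * (a * r) + a * c"
      by (simp add: algebra_simps power2_eq_square)
    also have "\<dots> = 0" unfolding ar using d2 by (simp add: algebra_simps power2_eq_square)
    finally show ?thesis .
  qed
  moreover have "a * (s\<^sup>2 * a + 2 * s * b + c) = 0"
  proof -
    have "a * (s\<^sup>2 * a + 2 * s * b + c) = (a * s)\<^sup>2 + 2 * b * (a * s) + a * c"
      by (simp add: algebra_simps power2_eq_square)
    also have "\<dots> = 0" unfolding as using d2 by (simp add: algebra_simps power2_eq_square)
    finally show ?thesis .
  qed
  ultimately show thesis
    using that[of s r] assms by simp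
qed

lemma cone_nonneg_cross_ineq:
  fixes G Q :: "real ^ 'n ^ 'n"
  assumes G: "symmetric G" and Q: "symmetric Q"
    and null: "\<And>k. k \<bullet> (G *v k) = 0 \<Longrightarrow> 0 \<le> k \<bullet> (Q *v k)"
    and u: "u \<bullet> (G *v u) < 0" and v: "0 < v \<bullet> (G *v v)"
  shows "(v \<bullet> (Q *v v)) * (u \<bullet> (G *v u)) \<le> (u \<bullet> (Q *v u)) * (v \<bullet> (G *v v))"
proof -
  define a c where "a = u \<bullet> (G *v u)" and "c = v \<bullet> (G *v v)"
  define A B C where "A = u \<bullet> (Q *v u)" and "B = u \<bullet> (Q *v v)" and "C = v \<bullet> (Q *v v)"
  from u v have "a < 0" "0 < c"
    by (simp_all add: a_def c_def)
  then obtain r s where rs: "s < 0" "0 < r" "a * (r * s) = c"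
    and "r\<^sup>2 * a + 2 * r * (u \<bullet> (G *v v)) + c = 0" "s\<^sup>2 * a + 2 * s * (u \<bullet> (G *v v)) + c = 0"
    by (rule quadratic_roots_opposite_signs)
  then have "0 \<le> (r *\<^sub>R u + v) \<bullet> (Q *v (r *\<^sub>R u + v))" "0 \<le> (s *\<^sub>R u + v) \<bullet> (Q *v (s *\<^sub>R u + v))"
    by (auto intro!: null simp: quadratic_form_add_scaled[OF G] a_def c_def)
  then have "0 \<le> r\<^sup>2 * A + 2 * r * B + C" "0 \<le> s\<^sup>2 * A + 2 * s * B + C"
    by (simp_all add: quadratic_form_add_scaled[OF Q] A_def B_def C_def)
  \<comment> \<open>The positive weights \<open>- s\<close> and \<open>r\<close> are chosen to
    cancel the mixed term \<open>B\<close>.\<close>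
  then have "0 \<le> (- s) * (r\<^sup>2 * A + 2 * r * B + C) + r * (s\<^sup>2 * A + 2 * s * B + C)"
    using rs by (metis add_nonneg_nonneg less_imp_le mult_nonneg_nonneg neg_0_le_iff_le)
  also have "\<dots> = (r - s) * (C - r * s * A)"
    by (simp add: algebra_simps power2_eq_square)
  finally have "0 \<le> C - r * s * A"
    using rs by (simp add: zero_le_mult_iff)
  then have "a * (C - r * s * A) \<le> 0"
    using \<open>a < 0\<close> by (simp add: mult_nonpos_nonneg)
  also have "a * (C - r * s * A) = C * a - A * c"
    unfolding rs(3)[symmetric] by (simp add: algebra_simps)
  finally show ?thesis
    by (simp add: a_def c_def A_def C_def)
qed

text \<open>The infimum is used, rather than just any multiplier, because its sign is needed for the WEC.\<close>

lemma cone_multiplier: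
  fixes G Q :: "real ^ 'n ^ 'n"
  assumes G: "symmetric G" and Q: "symmetric Q"
    and null: "\<And>k. k \<bullet> (G *v k) = 0 \<Longrightarrow> 0 \<le> k \<bullet> (Q *v k)"
    and u0: "u0 \<bullet> (G *v u0) < 0" and v0: "0 < v0 \<bullet> (G *v v0)"
  defines "\<sigma> \<equiv> INF u\<in>{u. u \<bullet> (G *v u) < 0}. (u \<bullet> (Q *v u)) / - (u \<bullet> (G *v u))"
  shows "0 \<le> x \<bullet> (Q *v x) + \<sigma> * (x \<bullet> (G *v x))"
proof -
  have lower: "- (v \<bullet> (Q *v v)) / (v \<bullet> (G *v v)) \<le> (u \<bullet> (Q *v u)) / - (u \<bullet> (G *v u))"
    if "u \<bullet> (G *v u) < 0" "0 < v \<bullet> (G *v v)" for u v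
    using cone_nonneg_cross_ineq[OF G Q null that] that by (simp add: field_simps)
  consider "x \<bullet> (G *v x) < 0" | "x \<bullet> (G *v x) = 0" | "0 < x \<bullet> (G *v x)"
    by linarith
  then show ?thesis
  proof cases
    case 1
    have "\<sigma> \<le> (x \<bullet> (Q *v x)) / - (x \<bullet> (G *v x))"
      unfolding \<sigma>_def
    proof (rule cINF_lower)
      show "bdd_below ((\<lambda>u. (u \<bullet> (Q *v u)) / - (u \<bullet> (G *v u))) ` {u. u \<bullet> (G *v u) < 0})"
        \<comment> \<open>The single vector \<open>v0\<close> bounds every quotient from below, so
          the infimum is a genuine one.\<close>
        using lower[OF _ v0] by (intro bdd_belowI2) blast
    qed (use 1 in simp)
    then show ?thesis
      using 1 by (simp add: field_simps)
  next
    case 2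
    then show ?thesis
      using null by simp
  next
    case 3
    have "- (x \<bullet> (Q *v x)) / (x \<bullet> (G *v x)) \<le> \<sigma>"
      unfolding \<sigma>_def
    proof (rule cINF_greatest)
      show "{u. u \<bullet> (G *v u) < 0} \<noteq> {}"
        using u0 by blast
    qed (use 3 in \<open>auto intro: lower simp del: divide_minus_right divide_minus_left\<close>)
    then show ?thesis
      using 3 by (simp add: field_simps)
  qed
qed

text \<open>A vector with \<open>G\<close>-square zero is a limit of vectors with negative
  \<open>G\<close>-square, and the form of \<open>Q\<close> is continuous. This supplies the null
  hypothesis of the S-lemma under the WEC.\<close>

lemma quadratic_form_nonneg_closure:
  fixes G Q :: "real ^ 'n ^ 'n"
  assumes G: "symmetric G"
    and neg: "\<And>u. u \<bullet> (G *v u) < 0 \<Longrightarrow> 0 \<le> u \<bullet> (Q *v u)"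
    and u0: "u0 \<bullet> (G *v u0) < 0" and k: "k \<bullet> (G *v k) = 0"
  shows "0 \<le> k \<bullet> (Q *v k)"
proof -
  \<comment> \<open>The sign makes the cross term nonpositive, so \<open>c w + k\<close> has
    negative \<open>G\<close>-square for every \<open>c > 0\<close>.\<close>
  define w where "w = (if u0 \<bullet> (G *v k) \<le> 0 then u0 else - u0)"
  have w: "w \<bullet> (G *v w) < 0" "w \<bullet> (G *v k) \<le> 0"
    using u0 by (auto simp: w_def linear_neg[OF matrix_vector_mul_linear])
  have "0 \<le> (c *\<^sub>R w + k) \<bullet> (Q *v (c *\<^sub>R w + k))" if "0 < c" for c :: real
  proof (rule neg)
    have "c\<^sup>2 * (w \<bullet> (G *v w)) < 0" "2 * c * (w \<bullet> (G *v k)) \<le> 0"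
      using that w by (simp_all add: mult_pos_neg mult_nonneg_nonpos)
    then show "(c *\<^sub>R w + k) \<bullet> (G *v (c *\<^sub>R w + k)) < 0"
      by (simp add: quadratic_form_add_scaled[OF G] k)
  qed
  then have "\<forall>\<^sub>F c in at_right 0. 0 \<le> (c *\<^sub>R w + k) \<bullet> (Q *v (c *\<^sub>R w + k))"
    by (auto simp: eventually_at_filter)
  moreover have "((\<lambda>c. (c *\<^sub>R w + k) \<bullet> (Q *v (c *\<^sub>R w + k)))
      \<longlongrightarrow> (0 *\<^sub>R w + k) \<bullet> (Q *v (0 *\<^sub>R w + k))) (at_right 0)"
    by (intro tendsto_intros bounded_linear.tendsto[OF matrix_vector_mul_bounded_linear])
  ultimately show ?thesis
    using tendsto_lowerbound trivial_limit_at_right_real by fastforce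
qed

subsection \<open>Orthonormal tetrads\<close>

text \<open>\<open>exhaust_4\<close> lists 1 to 4; here 4 is 0, the time index.\<close>

lemma UNIV_4_from_0: "(UNIV :: 4 set) = {0, 1, 2, 3}"
proof -
  have "i \<in> {0, 1, 2, 3}" for i :: 4
    using exhaust_4[of i] by auto
  then show ?thesis
    by blast
qed

lemma sum_4_from_0: "sum f (UNIV :: 4 set) = f 0 + f 1 + f 2 + f 3"
  unfolding UNIV_4_from_0 by (simp add: add.assoc)

definition frame_matrix :: "(4 \<Rightarrow> real ^ 4) \<Rightarrow> real ^ 4 ^ 4" where
  "frame_matrix E = (\<chi> a \<mu>. E \<mu> $ a)"

lemma frame_components_eq: "frame_components E T = transpose (frame_matrix E) ** T ** frame_matrix E"
  by (simp add: vec_eq_iff frame_components_def frame_matrix_def contract_def matrix_matrix_mult_def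
      transpose_def sum_4_from_0 algebra_simps)

lemma matrix_add_rdistrib:
  fixes A B :: "'a::semiring_1 ^ 'n ^ 'm"
  shows "(A + B) ** C = A ** C + B ** C"
  by (simp add: vec_eq_iff matrix_matrix_mult_def sum.distrib distrib_right)

lemma symmetric_congruence:
  fixes A P :: "real ^ 'n ^ 'n"
  assumes "symmetric A"
  shows "symmetric (transpose P ** A ** P)"
  using assms by (simp add: symmetric_def matrix_transpose_mul transpose_transpose matrix_mul_assoc)

lemma quadratic_form_congruence:
  fixes A P :: "real ^ 'n ^ 'n"
  shows "x \<bullet> ((transpose P ** A ** P) *v y) = (P *v x) \<bullet> (A *v (P *v y))"
  by (metis dot_lmul_matrix matrix_vector_mul_assoc transpose_matrix_vector transpose_transpose)

lemma minkowski_form: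
  "x \<bullet> (minkowski *v y) = - (x $ 0 * y $ 0) + x $ 1 * y $ 1 + x $ 2 * y $ 2 + x $ 3 * y $ 3"
  by (simp add: inner_vec_def matrix_vector_mult_def minkowski_def sum_4_from_0)

text \<open>The matrix is its own inverse. Through a congruence to \<open>minkowski\<close>, this
  yields invertibility of the metric and of the frame matrix.\<close>

lemma det_minkowski_nonzero: "det minkowski \<noteq> 0"
proof -
  have "minkowski ** minkowski = mat 1"
    by (simp add: vec_eq_iff matrix_matrix_mult_def minkowski_def mat_def sum_4_from_0)
       (metis UNIV_I UNIV_4_from_0 empty_iff insert_iff)
  then show ?thesis
    by (metis det_I det_mul mult_zero_left zero_neq_one)
qed

lemma orthonormal_tetrad_frame:
  assumes "symmetric g" "orthonormal_tetrad g n e1 e2 e3"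
  shows "frame_components (tetrad n e1 e2 e3) g = minkowski"
proof -
  define E where "E = tetrad n e1 e2 e3"
  have E0: "E 0 = n"
    by (simp add: E_def tetrad_def)
  have spatial: "i \<in> {1, 2, 3}" if "i \<noteq> 0" for i :: 4
    using that UNIV_I[of i] unfolding UNIV_4_from_0 by blast
  note tet = assms(2)[unfolded orthonormal_tetrad_def, folded E_def]
  have time: "contract g n n = - 1"
    using tet by blast
  have mixed: "contract g n (E i) = 0" "contract g (E i) n = 0" if "i \<noteq> 0" for i
    using tet spatial[OF that] contract_commute[OF assms(1), of "E i" n] by auto
  have space: "contract g (E i) (E j) = (if i = j then 1 else 0)" if "i \<noteq> 0" "j \<noteq> 0" for i j
    using tet spatial[OF that(1)] spatial[OF that(2)] by blast
  have "contract g (E i) (E j) = minkowski $ i $ j" for i j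
    by (cases "i = 0"; cases "j = 0") (simp_all add: minkowski_def E0 time mixed space)
  then show ?thesis
    by (simp add: vec_eq_iff frame_components_def E_def)
qed

subsection \<open>Causal vectors\<close>

text \<open>Orthogonality equates the product of the time components with the spatial inner product.
  By Cauchy-Schwarz and \<open>X < (x $ 0)\<^sup>2\<close> the time component of \<open>y\<close>
  must vanish, and causality then kills its spatial part.\<close>

lemma minkowski_timelike_causal_not_orthogonal:
  assumes x: "x \<bullet> (minkowski *v x) < 0" and y: "y \<bullet> (minkowski *v y) \<le> 0" and "y \<noteq> 0"
  shows "x \<bullet> (minkowski *v y) \<noteq> 0"
proof
  assume orth: "x \<bullet> (minkowski *v y) = 0"
  define X Y where "X = (x $ 1)\<^sup>2 + (x $ 2)\<^sup>2 + (x $ 3)\<^sup>2" and "Y = (y $ 1)\<^sup>2 + (y $ 2)\<^sup>2 + (y $ 3)\<^sup>2"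
  have X: "X < (x $ 0)\<^sup>2" "0 \<le> X" and Y: "Y \<le> (y $ 0)\<^sup>2" "0 \<le> Y"
    using x y by (simp_all add: X_def Y_def minkowski_form power2_eq_square)
  have "(x $ 0)\<^sup>2 * (y $ 0)\<^sup>2 = (x $ 1 * y $ 1 + x $ 2 * y $ 2 + x $ 3 * y $ 3)\<^sup>2"
  proof -
    have "x $ 0 * y $ 0 = x $ 1 * y $ 1 + x $ 2 * y $ 2 + x $ 3 * y $ 3"
      using orth by (simp add: minkowski_form)
    then show ?thesis
      by (simp flip: power_mult_distrib)
  qed
  \<comment> \<open>Lagrange's identity: the subtracted squares are those of the components of the
    cross product.\<close>
  also have "\<dots> = X * Y - ((x $ 1 * y $ 2 - x $ 2 * y $ 1)\<^sup>2
      + (x $ 1 * y $ 3 - x $ 3 * y $ 1)\<^sup>2 + (x $ 2 * y $ 3 - x $ 3 * y $ 2)\<^sup>2)"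
    by (simp add: X_def Y_def power2_eq_square algebra_simps)
  also have "\<dots> \<le> X * Y"
    by (simp only: diff_le_eq le_add_same_cancel1 add_nonneg_nonneg zero_le_power2)
  also have "\<dots> \<le> X * (y $ 0)\<^sup>2"
    using X Y by (intro mult_left_mono)
  finally have "((x $ 0)\<^sup>2 - X) * (y $ 0)\<^sup>2 \<le> 0"
    by (simp add: algebra_simps)
  then have y0: "y $ 0 = 0"
    using X by (simp add: mult_le_0_iff)
  then have "Y = 0"
    using Y by simp
  then have "y $ 1 = 0" "y $ 2 = 0" "y $ 3 = 0"
    unfolding Y_def by (smt (verit) zero_le_power2 power_eq_0_iff)+
  with y0 have "y $ i = 0" for i
    using UNIV_I[of i] unfolding UNIV_4_from_0 by auto
  with \<open>y \<noteq> 0\<close> show False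
    by (simp add: vec_eq_iff)
qed

lemma lorentzian_timelike_causal_not_orthogonal:
  assumes "lorentzian g" "timelike g u" "contract g v v \<le> 0" "v \<noteq> 0"
  shows "contract g u v \<noteq> 0"
proof -
  from assms(1) obtain P where "invertible P" and P: "transpose P ** g ** P = minkowski"
    unfolding lorentzian_def by blast
  then obtain x y where xy: "u = P *v x" "v = P *v y"
    by (metis invertible_def matrix_vector_mul_assoc matrix_vector_mul_lid)
  have "contract g (P *v a) (P *v b) = a \<bullet> (minkowski *v b)" for a b
    unfolding contract_eq_inner P[symmetric] quadratic_form_congruence ..
  moreover have "y \<noteq> 0"
    using assms(4) xy by auto
  ultimately show ?thesis
    using minkowski_timelike_causal_not_orthogonal[of x y] assms(2,3) xy by (simp add: timelike_def)
qed

text \<open>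
  If \<open>t\<close> and \<open>u\<close> were not strictly on the same side of the hyperplane orthogonal to \<open>v\<close>, then
  some \<open>t + c u\<close> with \<open>c \<ge> 0\<close> would be timelike and orthogonal to \<open>v\<close>.
\<close>

lemma same_half_cone:
  assumes g: "lorentzian g" and t: "timelike g t" and u: "timelike g u" and tu: "contract g t u < 0"
    and v: "contract g v v \<le> 0" "v \<noteq> 0" and uv: "contract g u v < 0"
  shows "contract g t v < 0"
proof (rule ccontr)
  assume "\<not> contract g t v < 0"
  \<comment> \<open>This value solves \<open>c g(u,v) + g(t,v) = 0\<close>.\<close>
  define c where "c = contract g t v / - contract g u v"
  have "0 \<le> c"
    using \<open>\<not> contract g t v < 0\<close> uv by (simp add: c_def divide_nonneg_neg)
  have sym: "symmetric g"
    using g by (simp add: lorentzian_def)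
  have "c\<^sup>2 * contract g u u \<le> 0" "2 * c * contract g u t \<le> 0"
    using \<open>0 \<le> c\<close> u tu contract_commute[OF sym, of u t]
    by (auto simp: timelike_def intro: mult_nonneg_nonpos)
  then have "timelike g (c *\<^sub>R u + t)"
    using t by (simp add: timelike_def contract_eq_inner quadratic_form_add_scaled[OF sym])
  then have "contract g (c *\<^sub>R u + t) v \<noteq> 0"
    using lorentzian_timelike_causal_not_orthogonal[OF g _ v] by blast
  moreover have "contract g (c *\<^sub>R u + t) v = c * contract g u v + contract g t v"
    by (simp add: contract_eq_inner inner_add_left)
  ultimately show False
    using uv by (simp add: c_def)
qed

subsection \<open>The energy conditions\<close>

lemma lorentzian_invertible:
  assumes "lorentzian g"
  shows "invertible g"
proof -
  from assms obtain P where "transpose P ** g ** P = minkowski"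
    unfolding lorentzian_def by blast
  then have "det g \<noteq> 0"
    using det_minkowski_nonzero by (metis det_mul mult_zero_left mult_zero_right)
  then show ?thesis
    by (simp add: invertible_det_nz)
qed

lemma matrix_inv_right:
  fixes A :: "'a::semiring_1 ^ 'n ^ 'm"
  assumes "invertible A"
  shows "A ** matrix_inv A = mat 1"
  using someI_ex[OF assms[unfolded invertible_def]] by (simp add: matrix_inv_def)

text \<open>The frame matrix \<open>P\<close> is invertible, so \<open>P x\<close> runs through all
  tangent vectors as \<open>x\<close> runs through all component vectors.\<close>

lemma psd_frame_iff:
  assumes "lorentzian g" "symmetric T" "orthonormal_tetrad g n e1 e2 e3"
  shows "psd (frame_components (tetrad n e1 e2 e3) T + \<sigma> *\<^sub>R minkowski)
    \<longleftrightarrow> (\<forall>u. 0 \<le> contract T u u + \<sigma> * contract g u u)"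
proof -
  define P where "P = frame_matrix (tetrad n e1 e2 e3)"
  have sym: "symmetric g"
    using assms(1) by (simp add: lorentzian_def)
  have g: "transpose P ** g ** P = minkowski"
    using orthonormal_tetrad_frame[OF sym assms(3)] by (simp add: frame_components_eq P_def)
  then have "det P \<noteq> 0"
    using det_minkowski_nonzero by (metis det_mul mult_zero_right)
  then obtain P' where P': "P ** P' = mat 1"
    by (metis invertible_det_nz invertible_def)
  have "symmetric (T + \<sigma> *\<^sub>R g)"
    using assms(2) sym by (simp add: symmetric_def transpose_def vec_eq_iff)
  moreover have eq: "frame_components (tetrad n e1 e2 e3) T + \<sigma> *\<^sub>R minkowski
      = transpose P ** (T + \<sigma> *\<^sub>R g) ** P"
    by (simp add: frame_components_eq P_def[symmetric] g[symmetric] matrix_add_ldistrib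
        matrix_add_rdistrib scalar_matrix_assoc matrix_scalar_ac)
  ultimately have "psd (frame_components (tetrad n e1 e2 e3) T + \<sigma> *\<^sub>R minkowski)
      \<longleftrightarrow> (\<forall>x. 0 \<le> (P *v x) \<bullet> ((T + \<sigma> *\<^sub>R g) *v (P *v x)))"
    unfolding psd_def eq by (simp add: symmetric_congruence quadratic_form_congruence)
  also have "\<dots> \<longleftrightarrow> (\<forall>u. 0 \<le> u \<bullet> ((T + \<sigma> *\<^sub>R g) *v u))"
    using P' by (metis matrix_vector_mul_assoc matrix_vector_mul_lid)
  finally show ?thesis
    by (simp add: contract_eq_inner matrix_vector_mult_add_rdistrib inner_add_right
        scaleR_matrix_vector_assoc[symmetric])
qed

lemma NEC_iff_psd:
  assumes g: "lorentzian g" and T: "symmetric T" and tetrad: "orthonormal_tetrad g n e1 e2 e3"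
  shows "NEC g T \<longleftrightarrow> (\<exists>\<sigma>. psd (frame_components (tetrad n e1 e2 e3) T + \<sigma> *\<^sub>R minkowski))"
  unfolding psd_frame_iff[OF assms]
proof
  assume "NEC g T"
  then have "0 \<le> k \<bullet> (T *v k)" if "k \<bullet> (g *v k) = 0" for k
    \<comment> \<open>The zero vector is not \<open>null\<close>, but both forms vanish
      there.\<close>
    using that by (cases "k = 0") (auto simp: NEC_def null_def contract_eq_inner)
  moreover have "n \<bullet> (g *v n) < 0" "0 < e1 \<bullet> (g *v e1)"
    using tetrad by (auto simp: orthonormal_tetrad_def contract_eq_inner tetrad_def)
  ultimately show "\<exists>\<sigma>. \<forall>u. 0 \<le> contract T u u + \<sigma> * contract g u u"
    using cone_multiplier[OF _ T] g unfolding contract_eq_inner lorentzian_def by blast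
next
  assume "\<exists>\<sigma>. \<forall>u. 0 \<le> contract T u u + \<sigma> * contract g u u"
  then show "NEC g T"
    unfolding NEC_def null_def by (metis add_0_right mult_zero_right)
qed

lemma WEC_iff_psd:
  assumes g: "lorentzian g" and T: "symmetric T" and tetrad: "orthonormal_tetrad g n e1 e2 e3"
  shows "WEC g T \<longleftrightarrow> (\<exists>\<sigma>\<ge>0. psd (frame_components (tetrad n e1 e2 e3) T + \<sigma> *\<^sub>R minkowski))"
  unfolding psd_frame_iff[OF assms]
proof
  assume "WEC g T"
  then have wec: "0 \<le> u \<bullet> (T *v u)" if "u \<bullet> (g *v u) < 0" for u
    using that by (auto simp: WEC_def timelike_def contract_eq_inner)
  have sym: "symmetric g"
    using g by (simp add: lorentzian_def)
  have ne: "n \<bullet> (g *v n) < 0" "0 < e1 \<bullet> (g *v e1)"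
    using tetrad by (auto simp: orthonormal_tetrad_def contract_eq_inner tetrad_def)
  define \<sigma> where "\<sigma> = (INF u\<in>{u. u \<bullet> (g *v u) < 0}. (u \<bullet> (T *v u)) / - (u \<bullet> (g *v u)))"
  have "0 \<le> x \<bullet> (T *v x) + \<sigma> * (x \<bullet> (g *v x))" for x
    unfolding \<sigma>_def
    by (rule cone_multiplier[OF sym T quadratic_form_nonneg_closure[OF sym wec ne(1)] ne])
  \<comment> \<open>Under the WEC every quotient in the infimum is nonnegative.\<close>
  moreover have "0 \<le> \<sigma>"
    unfolding \<sigma>_def using ne wec
    by (intro cINF_greatest) (auto intro!: divide_nonneg_pos simp del: divide_minus_right)
  ultimately show "\<exists>\<sigma>\<ge>0. \<forall>u. 0 \<le> contract T u u + \<sigma> * contract g u u"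
    unfolding contract_eq_inner by blast
next
  assume "\<exists>\<sigma>\<ge>0. \<forall>u. 0 \<le> contract T u u + \<sigma> * contract g u u"
  then show "WEC g T"
    unfolding WEC_def timelike_def by (smt (verit) mult_nonneg_nonpos)
qed

lemma symmetric_trace_reversed:
  assumes "symmetric g" "symmetric T"
  shows "symmetric (trace_reversed g T)"
  using assms by (simp add: trace_reversed_def symmetric_def transpose_def vec_eq_iff)

lemma contract_metric_flux:
  assumes "lorentzian g"
  shows "contract g v (- ((matrix_inv g ** T) *v u)) = - contract T v u"
proof -
  have "g ** (matrix_inv g ** T) = T"
    using lorentzian_invertible[OF assms]
    by (simp add: matrix_mul_assoc matrix_inv_right)
  then show ?thesis
    by (simp add: contract_eq_inner linear_neg[OF matrix_vector_mul_linear] matrix_vector_mul_assoc)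
qed

text \<open>Lowering the index of the flux \<open>J\<close> gives \<open>- T u\<close>, so
  \<open>g(J,J) = - T(J,u)\<close>, and inserting \<open>J\<close> once more produces the square of
  \<open>T\<close>.\<close>

lemma contract_flux_flux:
  assumes "lorentzian g" "symmetric T"
  shows "contract g (- ((matrix_inv g ** T) *v u)) (- ((matrix_inv g ** T) *v u))
    = contract (tensor_square g T) u u"
proof -
  have "contract T ((matrix_inv g ** T) *v u) u = contract (tensor_square g T) u u"
    unfolding contract_commute[OF assms(2), of _ u]
    by (simp add: contract_eq_inner tensor_square_def matrix_vector_mul_assoc matrix_mul_assoc)
  moreover have "contract T (- w) u = - contract T w u" for w
    by (simp add: contract_eq_inner)
  ultimately show ?thesis
    unfolding contract_metric_flux[OF assms(1)] by simp
qed

lemma contract_uminus: "contract (- A) u v = - contract A u v"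
  by (simp add: contract_def sum_negf)

lemma DEC_iff_WEC:
  assumes g: "lorentzian g" and T: "symmetric T" and t: "timelike g t"
  shows "DEC g t T \<longleftrightarrow> WEC g T \<and> WEC g (- tensor_square g T)"
proof
  assume dec: "DEC g t T"
  have "0 \<le> contract T u u \<and> contract (tensor_square g T) u u \<le> 0" if u: "timelike g u" for u
  proof -
    have even: "contract A (- u) (- u) = contract A u u" for A
      by (simp add: contract_def)
    have "u \<noteq> 0"
      using u by (auto simp: timelike_def contract_def)
    then have "contract g t u \<noteq> 0"
      using lorentzian_timelike_causal_not_orthogonal[OF g t] u by (simp add: timelike_def)
    \<comment> \<open>The DEC tests only future-directed vectors. Either \<open>u\<close> or
      \<open>- u\<close> is one, and quadratic forms do not see the sign.\<close>
    define w where "w = (if contract g t u < 0 then u else - u)"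
    have w: "contract A w w = contract A u u" for A
      by (simp add: w_def even)
    have "contract g t (- u) = - contract g t u"
      by (simp add: contract_eq_inner linear_neg[OF matrix_vector_mul_linear])
    then have "future_directed g t w" "timelike g w"
      using u \<open>u \<noteq> 0\<close> \<open>contract g t u \<noteq> 0\<close>
      by (cases "contract g t u < 0"; auto simp: future_directed_def timelike_def w_def even)+
    then show ?thesis
      using dec contract_flux_flux[OF g T, of w] w[of T] w[of "tensor_square g T"]
      unfolding DEC_def future_causal_def by metis
  qed
  then show "WEC g T \<and> WEC g (- tensor_square g T)"
    by (simp add: WEC_def contract_uminus)
next
  assume wec: "WEC g T \<and> WEC g (- tensor_square g T)"
  let ?J = "\<lambda>u. - ((matrix_inv g ** T) *v u)"
  show "DEC g t T"
    unfolding DEC_def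
  proof (intro allI impI conjI)
    fix u assume u: "timelike g u \<and> future_directed g t u"
    then show Tu: "contract T u u \<ge> 0"
      using wec by (simp add: WEC_def)
    have J: "contract g (?J u) (?J u) \<le> 0"
      using u wec by (simp add: WEC_def contract_uminus contract_flux_flux[OF g T])
    show "future_causal g t (?J u)"
    proof (cases "?J u = 0")
      case False
      \<comment> \<open>The value is \<open>- T(u,u)\<close>, hence nonpositive, and it is nonzero
        because \<open>J\<close> is causal and nonzero. The sign is then carried over from
        \<open>u\<close> to \<open>t\<close>.\<close>
      have "contract g u (?J u) < 0"
        using lorentzian_timelike_causal_not_orthogonal[OF g _ J False, of u] u Tu
        unfolding contract_metric_flux[OF g] by simp
      then have "contract g t (?J u) < 0"
        using same_half_cone[OF g t _ _ J False, of u] u by (simp add: future_directed_def)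
      with False J show ?thesis
        by (simp add: future_causal_def future_directed_def)
    qed (use J in \<open>simp add: future_causal_def\<close>)
  qed
qed

theorem theorem1:
  fixes g T :: "real ^ 4 ^ 4" and t n e1 e2 e3 :: "real ^ 4"
  assumes "lorentzian g"
    and "symmetric T"
    and "timelike g t"
    and "orthonormal_tetrad g n e1 e2 e3"
    and "timelike g n" and "future_directed g t n"
  shows "(NEC g T \<longleftrightarrow>
            (\<exists>\<sigma>. psd (frame_components (tetrad n e1 e2 e3) T + \<sigma> *\<^sub>R minkowski))) \<and>
         (WEC g T \<longleftrightarrow>
            (\<exists>\<sigma>\<ge>0. psd (frame_components (tetrad n e1 e2 e3) T + \<sigma> *\<^sub>R minkowski))) \<and>
         (SEC g T \<longleftrightarrow> WEC g (trace_reversed g T)) \<and>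
         (SEC g T \<longleftrightarrow>
            (\<exists>\<sigma>\<ge>0. psd (frame_components (tetrad n e1 e2 e3) (trace_reversed g T)
                       + \<sigma> *\<^sub>R minkowski))) \<and>
         (DEC g t T \<longleftrightarrow> WEC g T \<and> WEC g (- tensor_square g T))"
proof -
  have sec: "SEC g T \<longleftrightarrow> WEC g (trace_reversed g T)"
    by (simp add: SEC_def WEC_def trace_reversed_def)
  \<comment> \<open>Symmetry lets the WEC criterion be applied to the trace-reversed tensor.\<close>
  have "symmetric (trace_reversed g T)"
    using assms(1,2) by (simp add: symmetric_trace_reversed lorentzian_def)
  with assms show ?thesis
    unfolding sec by (intro conjI NEC_iff_psd WEC_iff_psd DEC_iff_WEC refl)
qed

end
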